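(* Let $X_1,\ldots,X_d$ be sequence classes and let $\gamma_s(\cdot;\mathbb{N}^d)$ be a $d$-sequence class such that $X_1(\mathbb{K})\cdots X_d(\mathbb{K})\stackrel{mult,1}{\hookrightarrow}\gamma_s(\mathbb{K};\mathbb{N}^d)$. Then the $(d+1)$-tuple $(X_1,\ldots,X_d,Y_{\gamma_s})$ is $\mathbb{N}^d$-compatible and $$\mathcal{L}_{X_1,\ldots,X_d;Y_{\gamma_s}}^{\mathbb{N}^d}(E_1,\ldots,E_d;F)=\mathcal{L}^m_{\gamma_s;X_1,\ldots,X_d}(E_1,\ldots,E_d;F)$$ isometrically (same operators, equal norms) for all Banach spaces $E_1,\ldots,E_d,F$.
   Context: All Banach spaces are over $\mathbb{K}=\mathbb{R}$ or $\mathbb{C}$; $\mathcal{L}(E_1,\ldots,E_d;F)$ is the Banach space of continuous $d$-linear operators with the usual operator norm. A sequence class is a rule $X$ assigning to each Banach space $E$ a Banach space $X(E)$ of $E$-valued sequences (with coordinatewise operations) such that $c_{00}(E)\subset X(E)\subset\ell_\infty(E)$ with $\|x\|_{\ell_\infty(E)}\le\|x\|_{X(E)}$ for $x\in X(E)$, and $\|e_j\|_{X(\mathbb{K})}=1$ for every $j$ ($c_{00}(E)$: eventually null sequences; $e_j$: canonical scalar unit sequences). A $d$-sequence in $E$ is a function $g:\mathbb{N}^d\to E$, also written $(x_{j^1,\ldots,j^d})_{j^1,\ldots,j^d=1}^\infty$. $c_{00}(E;\mathbb{N}^d)$ is the space of finitely supported $d$-sequences, $\ell_\infty(E;\mathbb{N}^d)$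 the space of bounded ones with the sup norm, and $e_{k^1,\ldots,k^d}$ is the scalar $d$-sequence equal to $1$ at $(k^1,\ldots,k^d)$ and $0$ elsewhere. A $d$-sequence class $\gamma_s(\cdot;\mathbb{N}^d)$ assigns to each Banach space $E$ a Banach space $\gamma_s(E;\mathbb{N}^d)$ of $E$-valued $d$-sequences (coordinatewise operations) with $c_{00}(E;\mathbb{N}^d)\subset\gamma_s(E;\mathbb{N}^d)\subset\ell_\infty(E;\mathbb{N}^d)$, $\|g\|_{\ell_\infty(E;\mathbb{N}^d)}\le\|g\|_{\gamma_s(E;\mathbb{N}^d)}$ for $g\in\gamma_s(E;\mathbb{N}^d)$, and $\|e_{k^1,\ldots,k^d}\|_{\gamma_s(\mathbb{K};\mathbb{N}^d)}=1$ for all $k^1,\ldots,k^d$. $A\in\mathcal{L}(E_1,\ldots,E_d;F)$ is multiple $(\gamma_s;X_1,\ldots,X_d)$-summing if $(A(x^1_{j^1},\ldots,x^d_{j^d}))_{j^1,\ldots,j^d=1}^\infty\in\gamma_s(F;\mathbb{N}^d)$ whenever $(x_j^r)_j\in X_r(E_r)$, $r=1,\ldots,d$. The set of these operators is $\mathcal{L}^m_{\gamma_s;X_1,\ldots,X_d}(E_1,\ldots,E_d;F)$, with norm the operator norm of the induced $d$-linear operator $X_1(E_1)\times\cdots\times X_d(E_d)\to\gamma_s(F;\mathbb{N}^d)$. $X_1(\mathbb{K})\cdots X_d(\mathbb{K})\stackrel{mult,1}{\hookrightarrow}\gamma_s(\mathbb{K};\mathbb{N}^d)$ means: whenever $(\lambda_j^r)_j\in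 X_r(\mathbb{K})$, $r=1,\ldots,d$, one has $(\lambda^1_{j_1}\cdots\lambda^d_{j_d})_{j_1,\ldots,j_d=1}^\infty\in\gamma_s(\mathbb{K};\mathbb{N}^d)$ with norm at most $\prod_{r=1}^d\|(\lambda_j^r)_j\|_{X_r(\mathbb{K})}$. Fix a bijection $\sigma:\mathbb{N}\to\mathbb{N}^d$ and write $\sigma(n)=(j_n^1,\ldots,j_n^d)$. $Y_{\gamma_s}$ is the sequence class $Y_{\gamma_s}(E)=\{(g\circ\sigma(n))_{n=1}^\infty: g\in\gamma_s(E;\mathbb{N}^d)\}$ with $\|(g\circ\sigma(n))_n\|_{Y_{\gamma_s}(E)}=\|g\|_{\gamma_s(E;\mathbb{N}^d)}$. The set $\mathbb{N}^d$ is regarded as the block associated to the trivial partition of $\{1,\ldots,d\}$ and to the sequences $(j_n^r)_n$, $r=1,\ldots,d$, given by $\sigma$. Accordingly, for a sequence class $Y$: $A\in\mathcal{L}^{\mathbb{N}^d}_{X_1,\ldots,X_d;Y}(E_1,\ldots,E_d;F)$ means $A\in\mathcal{L}(E_1,\ldots,E_d;F)$ and $(A(x^1_{j_n^1},\ldots,x^d_{j_n^d}))_{n=1}^\infty\in Y(F)$ whenever $(x_j^r)_j\in X_r(E_r)$, $r=1,\ldots,d$; its norm is the operator norm of the induced $d$-linear operator $\widehat{A}_{\mathbb{N}^d}:X_1(E_1)\times\cdots\times X_d(E_d)\to Y(F)$. The tuple $(X_1,\ldots,X_d,Y)$ is $\mathbb{N}^d$-compatible if for all $(\lambda_j^r)_j\in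 X_r(\mathbb{K})$ the sequence $(\lambda^1_{j_n^1}\cdots\lambda^d_{j_n^d})_{n=1}^\infty$ belongs to $Y(\mathbb{K})$ with norm at most $\prod_{r=1}^d\|(\lambda_j^r)_j\|_{X_r(\mathbb{K})}$. *)

theory Defs
  imports "HOL-Analysis.Analysis"
begin

section \<open>Normed and Banach spaces with an explicit carrier\<close>

text \<open>
  A statement about an arbitrary number of different Banach spaces, and about rules defined on all
  Banach spaces, cannot use one type per space. Spaces are therefore records, with the carrier
  a subset of a type \<^typ>\<open>'a\<close>. The scalar field is a type \<^typ>\<open>'k\<close> of class
  \<^class>\<open>real_normed_field\<close> and \<^class>\<open>banach\<close>; \<^typ>\<open>real\<close> and \<^typ>\<open>complex\<close> are instances and,
  by the Gelfand-Mazur theorem, the only ones up to isometric isomorphism.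
\<close>

record ('k, 'a) nspace =
  vcarrier :: "'a set"
  vzero :: 'a
  vadd :: "'a \<Rightarrow> 'a \<Rightarrow> 'a"
  vscale :: "'k \<Rightarrow> 'a \<Rightarrow> 'a"
  vnorm :: "'a \<Rightarrow> real"

locale normed_space =
  fixes E :: "('k::real_normed_field, 'a) nspace"
  assumes zero_closed: "vzero E \<in> vcarrier E"
    and add_closed: "\<lbrakk>x \<in> vcarrier E; y \<in> vcarrier E\<rbrakk> \<Longrightarrow> vadd E x y \<in> vcarrier E"
    and scale_closed: "x \<in> vcarrier E \<Longrightarrow> vscale E a x \<in> vcarrier E"
    and add_assoc: "\<lbrakk>x \<in> vcarrier E; y \<in> vcarrier E; z \<in> vcarrier E\<rbrakk>
          \<Longrightarrow> vadd E (vadd E x y) z = vadd E x (vadd E y z)"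
    and add_commute: "\<lbrakk>x \<in> vcarrier E; y \<in> vcarrier E\<rbrakk> \<Longrightarrow> vadd E x y = vadd E y x"
    and add_zero: "x \<in> vcarrier E \<Longrightarrow> vadd E x (vzero E) = x"
    and add_inverse: "x \<in> vcarrier E \<Longrightarrow> \<exists>y\<in>vcarrier E. vadd E x y = vzero E"
    and scale_add_right: "\<lbrakk>x \<in> vcarrier E; y \<in> vcarrier E\<rbrakk>
          \<Longrightarrow> vscale E a (vadd E x y) = vadd E (vscale E a x) (vscale E a y)"
    and scale_add_left: "x \<in> vcarrier E
          \<Longrightarrow> vscale E (a + b) x = vadd E (vscale E a x) (vscale E b x)"
    and scale_scale: "x \<in> vcarrier E \<Longrightarrow> vscale E a (vscale E b x) = vscale E (a * b) x"
    and scale_one: "x \<in> vcarrier E \<Longrightarrow> vscale E 1 x = x"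
    and norm_nonneg: "x \<in> vcarrier E \<Longrightarrow> 0 \<le> vnorm E x"
    and norm_zero_iff: "x \<in> vcarrier E \<Longrightarrow> vnorm E x = 0 \<longleftrightarrow> x = vzero E"
    and norm_triangle: "\<lbrakk>x \<in> vcarrier E; y \<in> vcarrier E\<rbrakk>
          \<Longrightarrow> vnorm E (vadd E x y) \<le> vnorm E x + vnorm E y"
    and norm_scale: "x \<in> vcarrier E \<Longrightarrow> vnorm E (vscale E a x) = norm a * vnorm E x"

text \<open>The value 0 off the carrier is there because \<^locale>\<open>Metric_space\<close> asks for nonnegativity
  and symmetry on the whole type.\<close>

definition vdist :: "('k::real_normed_field, 'a) nspace \<Rightarrow> 'a \<Rightarrow> 'a \<Rightarrow> real" where
  "vdist E x y = (if x \<in> vcarrier E \<and> y \<in> vcarrier E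
                  then vnorm E (vadd E x (vscale E (-1) y)) else 0)"

lemma (in normed_space) scale_zero_left: "x \<in> vcarrier E \<Longrightarrow> vscale E 0 x = vzero E"
  using norm_zero_iff[OF scale_closed, of x 0] norm_scale[of x 0] by simp

lemma (in normed_space) add_minus: 
  assumes "x \<in> vcarrier E" shows "vadd E x (vscale E (-1) x) = vzero E"
  using scale_add_left[OF assms, of 1 "-1"] scale_zero_left[OF assms] scale_one[OF assms] by simp

lemma (in normed_space) Metric_space_vdist: "Metric_space (vcarrier E) (vdist E)"
proof
  have minus_minus: "vscale E (-1) (vscale E (-1) x) = x" if "x \<in> vcarrier E" for x
    using that by (simp add: scale_scale scale_one)
  fix x y
  show "0 \<le> vdist E x y"
    by (simp add: vdist_def add_closed scale_closed norm_nonneg)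
  show "vdist E x y = vdist E y x"
  proof (cases "x \<in> vcarrier E \<and> y \<in> vcarrier E")
    case True
    have "vnorm E (vadd E x (vscale E (-1) y))
        = vnorm E (vscale E (-1) (vadd E x (vscale E (-1) y)))"
      using True by (simp add: norm_scale add_closed scale_closed)
    also have "vscale E (-1) (vadd E x (vscale E (-1) y)) = vadd E y (vscale E (-1) x)"
      using True by (simp add: scale_add_right scale_closed minus_minus add_commute)
    finally show ?thesis using True by (simp add: vdist_def)
  qed (auto simp: vdist_def)
  show "vdist E x y = 0 \<longleftrightarrow> x = y" if "x \<in> vcarrier E" "y \<in> vcarrier E"
  proof -
    have "x = y" if 0: "vadd E x (vscale E (-1) y) = vzero E"
    proof -
      have "x = vadd E x (vadd E (vscale E (-1) y) y)"
        using \<open>x \<in> _\<close> \<open>y \<in> _\<close> by (simp add: add_commute scale_closed add_minus add_zero)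
      also have "\<dots> = vadd E (vadd E x (vscale E (-1) y)) y"
        using \<open>x \<in> _\<close> \<open>y \<in> _\<close> by (simp add: add_assoc scale_closed)
      also have "\<dots> = y"
        using \<open>y \<in> _\<close> 0 by (simp add: add_commute zero_closed add_zero)
      finally show ?thesis .
    qed
    then show ?thesis
      using that by (auto simp: vdist_def norm_zero_iff add_closed scale_closed add_minus)
  qed
  fix z
  assume xyz: "x \<in> vcarrier E" "y \<in> vcarrier E" "z \<in> vcarrier E"
  have "vadd E x (vscale E (-1) z)
      = vadd E (vadd E x (vadd E (vscale E (-1) y) y)) (vscale E (-1) z)"
    using xyz by (simp add: add_commute[of "vscale E (-1) y"] scale_closed add_minus add_zero)
  also have "\<dots> = vadd E (vadd E x (vscale E (-1) y)) (vadd E y (vscale E (-1) z))"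
    using xyz by (simp add: add_assoc scale_closed add_closed)
  finally show "vdist E x z \<le> vdist E x y + vdist E y z"
    using xyz by (simp add: vdist_def norm_triangle add_closed scale_closed)
qed

definition vtopology :: "('k::real_normed_field, 'a) nspace \<Rightarrow> 'a topology" where
  "vtopology E = Metric_space.mtopology (vcarrier E) (vdist E)"

locale banach_space = normed_space +
  assumes complete: "Metric_space.mcomplete (vcarrier E) (vdist E)"

text \<open>The scalar field as one of the spaces under consideration. All Banach spaces have their
  elements in a type \<^typ>\<open>'k + 'u\<close>, with \<^typ>\<open>'u\<close> arbitrary, so that scalars are available
  among them.\<close>

definition scalar_space :: "('k::real_normed_field, 'k + 'u) nspace" where
  "scalar_space = \<lparr>vcarrier = range Inl, vzero = Inl 0,
     vadd = (\<lambda>x y. Inl (projl x + projl y)),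
     vscale = (\<lambda>a x. Inl (a * projl x)),
     vnorm = (\<lambda>x. norm (projl x))\<rparr>"

lemma scalar_space_banach:
  "banach_space (scalar_space :: ('k::{real_normed_field,banach}, 'k + 'u) nspace)"
    (is "banach_space ?K")
proof -
  interpret normed_space ?K
  proof
    fix x assume "x \<in> vcarrier ?K"
    then show "\<exists>y\<in>vcarrier ?K. vadd ?K x y = vzero ?K"
      by (intro bexI[of _ "Inl (- projl x)"]) (auto simp: scalar_space_def)
  qed (auto simp: scalar_space_def algebra_simps norm_triangle_ineq norm_mult)
  interpret M: Metric_space "vcarrier ?K" "vdist ?K" by (rule Metric_space_vdist)
  have d: "vdist ?K (Inl a) (Inl b) = dist a b" for a b
    by (simp add: vdist_def scalar_space_def dist_norm)
  have c: "vcarrier ?K = range Inl" by (simp add: scalar_space_def)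
  show ?thesis
  proof
    show M.mcomplete
      unfolding M.mcomplete_def
    proof (intro allI impI)
      fix s :: "nat \<Rightarrow> 'k + 'u"
      assume s: "M.MCauchy s"
      define t where "t = (\<lambda>n. projl (s n))"
      have s_t: "s n = Inl (t n)" for n
      proof -
        have "s n \<in> vcarrier ?K" using s unfolding M.MCauchy_def by blast
        then show ?thesis unfolding t_def c by auto
      qed
      have "Cauchy t"
      proof (unfold Cauchy_def, intro allI impI)
        fix \<epsilon> :: real assume "\<epsilon> > 0"
        then obtain N where N: "\<And>n n'. N \<le> n \<Longrightarrow> N \<le> n' \<Longrightarrow> vdist ?K (s n) (s n') < \<epsilon>"
          using s unfolding M.MCauchy_def by meson
        then show "\<exists>N. \<forall>m\<ge>N. \<forall>n\<ge>N. dist (t m) (t n) < \<epsilon>"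
          unfolding s_t d by (intro exI[of _ N]) simp
      qed
      then obtain l where "t \<longlonglongrightarrow> l"
        using Cauchy_convergent convergent_def by blast
      then have "limitin M.mtopology s (Inl l) sequentially"
        unfolding M.limit_metric_sequentially by (simp add: s_t d c LIMSEQ_def)
      then show "\<exists>x. limitin M.mtopology s x sequentially" by blast
    qed
  qed
qed


section \<open>Sequence classes and $d$-sequence classes\<close>

text \<open>
  Families in a space indexed by a type \<^typ>\<open>'i\<close>. Sequences are the case of \<^typ>\<open>nat\<close>. For a finite
  type \<^typ>\<open>'d\<close> of indices, standing for the set of the numbers from 1 to d, the product
  of d copies of the natural numbers is the type \<^typ>\<open>'d \<Rightarrow> nat\<close>, so d-sequences are the case of
  \<^typ>\<open>'d \<Rightarrow> nat\<close>.
\<close>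

definition coordinatewise ::
    "('k::real_normed_field, 'a) nspace \<Rightarrow> ('k, 'i \<Rightarrow> 'a) nspace \<Rightarrow> bool" where
  "coordinatewise E S \<longleftrightarrow>
     vzero S = (\<lambda>i. vzero E) \<and>
     (\<forall>x\<in>vcarrier S. \<forall>y\<in>vcarrier S. vadd S x y = (\<lambda>i. vadd E (x i) (y i))) \<and>
     (\<forall>a. \<forall>x\<in>vcarrier S. vscale S a x = (\<lambda>i. vscale E a (x i)))"

text \<open>For sequences, \<^const>\<open>cofinite\<close> equals \<^const>\<open>sequentially\<close>; in general
  the condition is finiteness of the support.\<close>

definition c00 :: "('k::real_normed_field, 'a) nspace \<Rightarrow> ('i \<Rightarrow> 'a) set" where
  "c00 E = {x. (\<forall>i. x i \<in> vcarrier E) \<and> (\<forall>\<^sub>F i in cofinite. x i = vzero E)}"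

definition linfty :: "('k::real_normed_field, 'a) nspace \<Rightarrow> ('i \<Rightarrow> 'a) set" where
  "linfty E = {x. (\<forall>i. x i \<in> vcarrier E) \<and> bdd_above (range (\<lambda>i. vnorm E (x i)))}"

definition linfty_norm :: "('k::real_normed_field, 'a) nspace \<Rightarrow> ('i \<Rightarrow> 'a) \<Rightarrow> real" where
  "linfty_norm E x = (SUP i. vnorm E (x i))"

definition unit_family :: "'i \<Rightarrow> 'i \<Rightarrow> 'k::real_normed_field + 'u" where
  "unit_family j = (\<lambda>i. Inl (if i = j then 1 else 0))"

text \<open>A rule that assigns to a space of elements in \<^typ>\<open>'k + 'u\<close> a space of \<^typ>\<open>'i\<close>-indexed
  families in it. Its values outside the Banach spaces are irrelevant.\<close>

type_synonym ('i, 'k, 'u) rule = "('k, 'k + 'u) nspace \<Rightarrow> ('k, 'i \<Rightarrow> 'k + 'u) nspace"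

definition family_class :: "('i, 'k::{real_normed_field,banach}, 'u) rule \<Rightarrow> bool" where
  "family_class X \<longleftrightarrow>
     (\<forall>E. banach_space E \<longrightarrow>
        banach_space (X E) \<and> coordinatewise E (X E) \<and>
        c00 E \<subseteq> vcarrier (X E) \<and> vcarrier (X E) \<subseteq> linfty E \<and>
        (\<forall>x\<in>vcarrier (X E). linfty_norm E x \<le> vnorm (X E) x)) \<and>
     (\<forall>j. vnorm (X scalar_space) (unit_family j) = 1)"

abbreviation sequence_class :: "(nat, 'k::{real_normed_field,banach}, 'u) rule \<Rightarrow> bool" where
  "sequence_class \<equiv> family_class"

abbreviation d_sequence_class ::
    "('d::finite \<Rightarrow> nat, 'k::{real_normed_field,banach}, 'u) rule \<Rightarrow> bool" where
  "d_sequence_class \<equiv> family_class"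


section \<open>Multilinear operators\<close>

definition multilinear_op ::
    "('d::finite \<Rightarrow> ('k::real_normed_field, 'a) nspace) \<Rightarrow> ('k, 'b) nspace
     \<Rightarrow> (('d \<Rightarrow> 'a) \<Rightarrow> 'b) \<Rightarrow> bool" where
  "multilinear_op E F A \<longleftrightarrow>
     (\<forall>x\<in>(\<Pi>\<^sub>E r\<in>UNIV. vcarrier (E r)). \<forall>r. \<forall>y\<in>vcarrier (E r). \<forall>z\<in>vcarrier (E r). \<forall>a.
        A (x(r := vadd (E r) y z)) = vadd F (A (x(r := y))) (A (x(r := z))) \<and>
        A (x(r := vscale (E r) a y)) = vscale F a (A (x(r := y))))"

text \<open>An operator is \<^const>\<open>undefined\<close> off the product of the domains, so that operators
  are equal as functions iff they agree on that product.\<close>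

definition cont_multilinear ::
    "('d::finite \<Rightarrow> ('k::real_normed_field, 'a) nspace) \<Rightarrow> ('k, 'b) nspace
     \<Rightarrow> (('d \<Rightarrow> 'a) \<Rightarrow> 'b) set" where
  "cont_multilinear E F =
     {A \<in> (\<Pi>\<^sub>E r\<in>UNIV. vcarrier (E r)) \<rightarrow>\<^sub>E vcarrier F.
        multilinear_op E F A \<and>
        continuous_map (product_topology (\<lambda>r. vtopology (E r)) UNIV) (vtopology F) A}"

text \<open>The operator norm takes extended real values, so that the definition makes sense without
  a prior proof that the operator is bounded.\<close>

definition op_norm ::
    "('d::finite \<Rightarrow> ('k::real_normed_field, 'a) nspace) \<Rightarrow> ('k, 'b) nspace
     \<Rightarrow> (('d \<Rightarrow> 'a) \<Rightarrow> 'b) \<Rightarrow> ereal" where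
  "op_norm E F T =
     (SUP x\<in>{x. \<forall>r. x r \<in> vcarrier (E r) \<and> vnorm (E r) (x r) \<le> 1}. ereal (vnorm F (T x)))"


section \<open>Multiple summing operators\<close>

definition multiple_induced ::
    "(('d::finite \<Rightarrow> 'a) \<Rightarrow> 'b) \<Rightarrow> ('d \<Rightarrow> nat \<Rightarrow> 'a) \<Rightarrow> ('d \<Rightarrow> nat) \<Rightarrow> 'b" where
  "multiple_induced A x = (\<lambda>j. A (\<lambda>r. x r (j r)))"

definition multiple_summing ::
    "('d::finite \<Rightarrow> nat, 'k::{real_normed_field,banach}, 'u) rule
     \<Rightarrow> ('d \<Rightarrow> (nat, 'k, 'u) rule)
     \<Rightarrow> ('d \<Rightarrow> ('k, 'k + 'u) nspace) \<Rightarrow> ('k, 'k + 'u) nspace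
     \<Rightarrow> (('d \<Rightarrow> 'k + 'u) \<Rightarrow> 'k + 'u) set" where
  "multiple_summing \<gamma> X E F =
     {A \<in> cont_multilinear E F.
        \<forall>x. (\<forall>r. x r \<in> vcarrier (X r (E r))) \<longrightarrow> multiple_induced A x \<in> vcarrier (\<gamma> F)}"

definition multiple_summing_norm ::
    "('d::finite \<Rightarrow> nat, 'k::{real_normed_field,banach}, 'u) rule
     \<Rightarrow> ('d \<Rightarrow> (nat, 'k, 'u) rule)
     \<Rightarrow> ('d \<Rightarrow> ('k, 'k + 'u) nspace) \<Rightarrow> ('k, 'k + 'u) nspace
     \<Rightarrow> (('d \<Rightarrow> 'k + 'u) \<Rightarrow> 'k + 'u) \<Rightarrow> ereal" where
  "multiple_summing_norm \<gamma> X E F A = op_norm (\<lambda>r. X r (E r)) (\<gamma> F) (multiple_induced A)"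

definition mult1_embedded ::
    "('d::finite \<Rightarrow> (nat, 'k::{real_normed_field,banach}, 'u) rule)
     \<Rightarrow> ('d \<Rightarrow> nat, 'k, 'u) rule \<Rightarrow> bool" where
  "mult1_embedded X \<gamma> \<longleftrightarrow>
     (\<forall>l :: 'd \<Rightarrow> nat \<Rightarrow> 'k.
        (\<forall>r. (\<lambda>j. Inl (l r j)) \<in> vcarrier (X r scalar_space)) \<longrightarrow>
        (\<lambda>j. Inl (\<Prod>r\<in>UNIV. l r (j r))) \<in> vcarrier (\<gamma> scalar_space) \<and>
        vnorm (\<gamma> scalar_space) (\<lambda>j. Inl (\<Prod>r\<in>UNIV. l r (j r)))
          \<le> (\<Prod>r\<in>UNIV. vnorm (X r scalar_space) (\<lambda>j. Inl (l r j))))"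


section \<open>The block $N^d$\<close>

text \<open>The block is given by an enumeration \<^term>\<open>\<sigma> :: nat \<Rightarrow> 'd \<Rightarrow> nat\<close>;
  the sequence with index r of the block is \<^term>\<open>\<lambda>n. \<sigma> n r\<close>.\<close>

definition block_induced ::
    "(nat \<Rightarrow> 'd::finite \<Rightarrow> nat) \<Rightarrow> (('d \<Rightarrow> 'a) \<Rightarrow> 'b) \<Rightarrow> ('d \<Rightarrow> nat \<Rightarrow> 'a) \<Rightarrow> nat \<Rightarrow> 'b" where
  "block_induced \<sigma> A x = (\<lambda>n. A (\<lambda>r. x r (\<sigma> n r)))"

definition block_summing ::
    "(nat \<Rightarrow> 'd::finite \<Rightarrow> nat)
     \<Rightarrow> ('d \<Rightarrow> (nat, 'k::{real_normed_field,banach}, 'u) rule) \<Rightarrow> (nat, 'k, 'u) rule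
     \<Rightarrow> ('d \<Rightarrow> ('k, 'k + 'u) nspace) \<Rightarrow> ('k, 'k + 'u) nspace
     \<Rightarrow> (('d \<Rightarrow> 'k + 'u) \<Rightarrow> 'k + 'u) set" where
  "block_summing \<sigma> X Y E F =
     {A \<in> cont_multilinear E F.
        \<forall>x. (\<forall>r. x r \<in> vcarrier (X r (E r))) \<longrightarrow> block_induced \<sigma> A x \<in> vcarrier (Y F)}"

definition block_summing_norm ::
    "(nat \<Rightarrow> 'd::finite \<Rightarrow> nat)
     \<Rightarrow> ('d \<Rightarrow> (nat, 'k::{real_normed_field,banach}, 'u) rule) \<Rightarrow> (nat, 'k, 'u) rule
     \<Rightarrow> ('d \<Rightarrow> ('k, 'k + 'u) nspace) \<Rightarrow> ('k, 'k + 'u) nspace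
     \<Rightarrow> (('d \<Rightarrow> 'k + 'u) \<Rightarrow> 'k + 'u) \<Rightarrow> ereal" where
  "block_summing_norm \<sigma> X Y E F A = op_norm (\<lambda>r. X r (E r)) (Y F) (block_induced \<sigma> A)"

definition block_compatible ::
    "(nat \<Rightarrow> 'd::finite \<Rightarrow> nat)
     \<Rightarrow> ('d \<Rightarrow> (nat, 'k::{real_normed_field,banach}, 'u) rule) \<Rightarrow> (nat, 'k, 'u) rule
     \<Rightarrow> bool" where
  "block_compatible \<sigma> X Y \<longleftrightarrow>
     (\<forall>l :: 'd \<Rightarrow> nat \<Rightarrow> 'k.
        (\<forall>r. (\<lambda>j. Inl (l r j)) \<in> vcarrier (X r scalar_space)) \<longrightarrow>
        (\<lambda>n. Inl (\<Prod>r\<in>UNIV. l r (\<sigma> n r))) \<in> vcarrier (Y scalar_space) \<and>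
        vnorm (Y scalar_space) (\<lambda>n. Inl (\<Prod>r\<in>UNIV. l r (\<sigma> n r)))
          \<le> (\<Prod>r\<in>UNIV. vnorm (X r scalar_space) (\<lambda>j. Inl (l r j))))"

text \<open>As \<^term>\<open>\<sigma>\<close> is a bijection, \<^term>\<open>x \<circ> inv \<sigma>\<close> is the only \<^term>\<open>g\<close>
  with \<^term>\<open>x = g \<circ> \<sigma>\<close>.\<close>

definition Y_class ::
    "(nat \<Rightarrow> 'd::finite \<Rightarrow> nat) \<Rightarrow> ('d \<Rightarrow> nat, 'k::{real_normed_field,banach}, 'u) rule
     \<Rightarrow> (nat, 'k, 'u) rule" where
  "Y_class \<sigma> \<gamma> = (\<lambda>E.
     \<lparr>vcarrier = {g \<circ> \<sigma> | g. g \<in> vcarrier (\<gamma> E)},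
      vzero = (\<lambda>n. vzero E),
      vadd = (\<lambda>x y n. vadd E (x n) (y n)),
      vscale = (\<lambda>a x n. vscale E a (x n)),
      vnorm = (\<lambda>x. vnorm (\<gamma> E) (x \<circ> inv \<sigma>))\<rparr>)"

lemma Y_class_sequence_class:
  fixes \<gamma> :: "('d::finite \<Rightarrow> nat, 'k::{real_normed_field,banach}, 'u) rule"
  assumes \<gamma>: "d_sequence_class \<gamma>" and \<sigma>: "bij \<sigma>"
  shows "sequence_class (Y_class \<sigma> \<gamma>)"
proof -
  note [simp] = bij_is_inj[OF \<sigma>]
  have \<sigma>i [simp]: "\<sigma> (inv \<sigma> j) = j" for j using \<sigma> by (simp add: bij_is_surj surj_f_inv_f)
  have comp [simp]: "(g \<circ> \<sigma>) \<circ> inv \<sigma> = g" for g :: "('d \<Rightarrow> nat) \<Rightarrow> 'k + 'u"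
    by (simp add: fun_eq_iff)
  have "banach_space (Y_class \<sigma> \<gamma> E) \<and> coordinatewise E (Y_class \<sigma> \<gamma> E) \<and>
        c00 E \<subseteq> vcarrier (Y_class \<sigma> \<gamma> E) \<and> vcarrier (Y_class \<sigma> \<gamma> E) \<subseteq> linfty E \<and>
        (\<forall>x\<in>vcarrier (Y_class \<sigma> \<gamma> E). linfty_norm E x \<le> vnorm (Y_class \<sigma> \<gamma> E) x)"
    if E: "banach_space E" for E
  proof -
    let ?G = "\<gamma> E" and ?Y = "Y_class \<sigma> \<gamma> E"
    have G: "banach_space ?G" "coordinatewise E ?G" "c00 E \<subseteq> vcarrier ?G"
      "vcarrier ?G \<subseteq> linfty E" "\<And>x. x \<in> vcarrier ?G \<Longrightarrow> linfty_norm E x \<le> vnorm ?G x"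
      using \<gamma> E by (auto simp: family_class_def)
    interpret G: banach_space ?G by (rule G(1))
    have carrier: "x \<in> vcarrier ?Y \<longleftrightarrow> (\<exists>g\<in>vcarrier ?G. x = g \<circ> \<sigma>)" for x
      by (auto simp: Y_class_def)
    have zero: "vzero ?Y = vzero ?G \<circ> \<sigma>"
      using G(2) by (simp add: Y_class_def coordinatewise_def fun_eq_iff)
    have add: "vadd ?Y (g \<circ> \<sigma>) (h \<circ> \<sigma>) = vadd ?G g h \<circ> \<sigma>"
      if "g \<in> vcarrier ?G" "h \<in> vcarrier ?G" for g h
      using G(2) that by (simp add: Y_class_def coordinatewise_def fun_eq_iff)
    have scale: "vscale ?Y a (g \<circ> \<sigma>) = vscale ?G a g \<circ> \<sigma>" if "g \<in> vcarrier ?G" for a g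
      using G(2) that by (simp add: Y_class_def coordinatewise_def fun_eq_iff)
    have norm: "vnorm ?Y (g \<circ> \<sigma>) = vnorm ?G g" for g
      by (simp only: Y_class_def nspace.simps comp)
    have inj: "g \<circ> \<sigma> = h \<circ> \<sigma> \<longleftrightarrow> g = h" for g h :: "('d \<Rightarrow> nat) \<Rightarrow> 'k + 'u"
      using comp by metis
    have mem: "g \<circ> \<sigma> \<in> vcarrier ?Y \<longleftrightarrow> g \<in> vcarrier ?G" for g
      by (auto simp: carrier inj)
    have E: "\<exists>g. g \<in> vcarrier ?G \<and> x = g \<circ> \<sigma>" if "x \<in> vcarrier ?Y" for x
      using that carrier by blast
    note tr = mem zero add scale norm inj
    interpret Y: normed_space ?Y
    proof
      fix x assume "x \<in> vcarrier ?Y"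
      then obtain g where g: "g \<in> vcarrier ?G" "x = g \<circ> \<sigma>" using E by blast
      then obtain h where "h \<in> vcarrier ?G" "vadd ?G g h = vzero ?G"
        using G.add_inverse by blast
      then show "\<exists>y\<in>vcarrier ?Y. vadd ?Y x y = vzero ?Y"
        using g by (intro bexI[of _ "h \<circ> \<sigma>"]) (auto simp: tr)
    qed (auto dest!: E simp: tr G.zero_closed G.add_closed G.scale_closed G.add_assoc G.add_zero
        G.scale_add_right G.scale_add_left G.scale_scale G.scale_one G.norm_nonneg
        G.norm_zero_iff G.norm_triangle G.norm_scale intro: G.add_commute)
    interpret MG: Metric_space "vcarrier ?G" "vdist ?G" by (rule G.Metric_space_vdist)
    interpret MY: Metric_space "vcarrier ?Y" "vdist ?Y" by (rule Y.Metric_space_vdist)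
    have dist: "vdist ?Y (g \<circ> \<sigma>) (h \<circ> \<sigma>) = vdist ?G g h" for g h
      by (simp add: vdist_def mem scale add norm G.scale_closed)
    have range_eq: "range (\<lambda>n. vnorm E (g (\<sigma> n))) = range (\<lambda>j. vnorm E (g j))" for g
      using image_comp[of "\<lambda>j. vnorm E (g j)" \<sigma> UNIV] bij_is_surj[OF \<sigma>] by (simp add: comp_def)
    have "banach_space ?Y"
    proof
      show MY.mcomplete
        unfolding MY.mcomplete_def
      proof (intro allI impI)
        fix s assume s: "MY.MCauchy s"
        define t where "t = (\<lambda>n. s n \<circ> inv \<sigma>)"
        have s_t: "s n = t n \<circ> \<sigma>" for n
          by (simp add: t_def fun_eq_iff)
        have "MG.MCauchy t"
          using s unfolding MY.MCauchy_def MG.MCauchy_def image_subset_iff s_t mem dist .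
        then obtain l where "limitin MG.mtopology t l sequentially"
          using G.complete MG.mcomplete_def by blast
        then have "limitin MY.mtopology s (l \<circ> \<sigma>) sequentially"
          unfolding MG.limit_metric_sequentially MY.limit_metric_sequentially s_t mem dist .
        then show "\<exists>x. limitin MY.mtopology s x sequentially" by blast
      qed
    qed
    moreover have "coordinatewise E ?Y"
      by (simp add: coordinatewise_def Y_class_def)
    moreover have "c00 E \<subseteq> vcarrier ?Y"
    proof
      fix x :: "nat \<Rightarrow> 'k + 'u" assume x: "x \<in> c00 E"
      have "{j. x (inv \<sigma> j) \<noteq> vzero E} \<subseteq> \<sigma> ` {n. x n \<noteq> vzero E}"
        by (auto intro!: image_eqI[of _ \<sigma> "inv \<sigma> _"])
      then have "x \<circ> inv \<sigma> \<in> c00 E"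
        using x by (auto simp: c00_def eventually_cofinite intro: finite_subset)
      then have "(x \<circ> inv \<sigma>) \<circ> \<sigma> \<in> vcarrier ?Y" using G(3) mem by blast
      then show "x \<in> vcarrier ?Y" by (simp add: o_assoc[symmetric])
    qed
    moreover have "x \<in> linfty E \<and> linfty_norm E x \<le> vnorm ?Y x" if x: "x \<in> vcarrier ?Y"
      for x :: "nat \<Rightarrow> 'k + 'u"
    proof -
      obtain g where g: "g \<in> vcarrier ?G" "x = g \<circ> \<sigma>" using x unfolding carrier by blast
      then have "g \<in> linfty E" "linfty_norm E g \<le> vnorm ?G g" using G(4,5) by auto
      then show ?thesis
        by (simp only: g(2) norm) (simp add: linfty_def linfty_norm_def range_eq)
    qed
    ultimately show ?thesis by blast
  qed
  moreover have "vnorm (Y_class \<sigma> \<gamma> scalar_space) (unit_family j) = 1" for j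
  proof -
    have "inv \<sigma> i = j \<longleftrightarrow> i = \<sigma> j" for i
      using \<sigma>i by (metis \<sigma> bij_inv_eq_iff)
    then have "unit_family j \<circ> inv \<sigma> = (unit_family (\<sigma> j) :: _ \<Rightarrow> 'k + 'u)"
      by (simp add: unit_family_def comp_def)
    then show ?thesis
      using \<gamma> by (simp add: Y_class_def family_class_def)
  qed
  ultimately show ?thesis by (simp add: family_class_def)
qed

end

theory Submission
  imports Defs
begin

text \<open>Composition with \<open>\<sigma>\<close> is a norm-preserving bijection from \<gamma>(E)
  onto \<open>Y_class \<sigma> \<gamma> E\<close>, by the very construction of the latter. The block
  family of A at x is the multiple family of A at x read along \<open>\<sigma>\<close>
  (\<open>block_induced_eq\<close>), and the products of scalars are re-indexed in the same way.
  Hence membership and norm conditions for \<open>Y_class \<sigma> \<gamma>\<close> become those for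
  \<gamma>, and each block notion turns into its multiple counterpart.\<close>

lemma comp_mem_Y_class:
  assumes "bij \<sigma>"
  shows "g \<circ> \<sigma> \<in> vcarrier (Y_class \<sigma> \<gamma> E) \<longleftrightarrow> g \<in> vcarrier (\<gamma> E)"
proof -
  \<comment> \<open>Membership of \<open>g \<circ> \<sigma>\<close> only provides some h in
    \<gamma>(E) with the same composite; surjectivity of \<open>\<sigma>\<close> forces h to be
    g.\<close>
  have "g = h" if "g \<circ> \<sigma> = h \<circ> \<sigma>" for h
    using that bij_is_surj[OF assms] by (metis surj_fun_eq UNIV_I comp_apply)
  then show ?thesis by (auto simp: Y_class_def)
qed

text \<open>The norm of \<open>Y_class\<close> is computed after composing with
  \<open>inv \<sigma>\<close>, and \<open>\<sigma> \<circ> inv \<sigma>\<close> is the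
  identity.\<close>

lemma vnorm_Y_class_comp:
  assumes "bij \<sigma>"
  shows "vnorm (Y_class \<sigma> \<gamma> E) (g \<circ> \<sigma>) = vnorm (\<gamma> E) g"
  using surj_iff[THEN iffD1, OF bij_is_surj[OF assms]] by (simp add: Y_class_def comp_assoc)

lemma block_induced_eq: "block_induced \<sigma> A x = multiple_induced A x \<circ> \<sigma>"
  by (simp add: block_induced_def multiple_induced_def comp_def)

theorem proposition3p3:
  fixes X :: "'d::finite \<Rightarrow> (nat, 'k::{real_normed_field,banach}, 'u) rule"
    and \<gamma> :: "('d \<Rightarrow> nat, 'k, 'u) rule"
    and \<sigma> :: "nat \<Rightarrow> 'd \<Rightarrow> nat"
  assumes "\<And>r. sequence_class (X r)"
    and "d_sequence_class \<gamma>"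
    and "bij \<sigma>"
    and "mult1_embedded X \<gamma>"
  shows "block_compatible \<sigma> X (Y_class \<sigma> \<gamma>) \<and>
    (\<forall>(E :: 'd \<Rightarrow> ('k, 'k + 'u) nspace) F.
       (\<forall>r. banach_space (E r)) \<longrightarrow> banach_space F \<longrightarrow>
       block_summing \<sigma> X (Y_class \<sigma> \<gamma>) E F = multiple_summing \<gamma> X E F \<and>
       (\<forall>A\<in>multiple_summing \<gamma> X E F.
          block_summing_norm \<sigma> X (Y_class \<sigma> \<gamma>) E F A = multiple_summing_norm \<gamma> X E F A))"
proof (intro conjI allI impI ballI)
  note Y = comp_mem_Y_class[OF \<open>bij \<sigma>\<close>] vnorm_Y_class_comp[OF \<open>bij \<sigma>\<close>]
  \<comment> \<open>In this form the rules \<open>Y\<close> apply and turn compatibility into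
    \<open>mult1_embedded\<close> word for word.\<close>
  have "(\<lambda>n. Inl (\<Prod>r\<in>UNIV. l r (\<sigma> n r))) = (\<lambda>j. Inl (\<Prod>r\<in>UNIV. l r (j r)) :: 'k + 'u) \<circ> \<sigma>"
    for l :: "'d \<Rightarrow> nat \<Rightarrow> 'k"
    by (simp add: comp_def)
  then show "block_compatible \<sigma> X (Y_class \<sigma> \<gamma>)"
    using \<open>mult1_embedded X \<gamma>\<close> by (simp only: block_compatible_def mult1_embedded_def Y)
  fix E :: "'d \<Rightarrow> ('k, 'k + 'u) nspace" and F
  show "block_summing \<sigma> X (Y_class \<sigma> \<gamma>) E F = multiple_summing \<gamma> X E F"
    by (simp only: block_summing_def multiple_summing_def block_induced_eq Y)
  \<comment> \<open>Both norms are suprema over the same product of unit balls, and the values agree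
    at each point.\<close>
  show "block_summing_norm \<sigma> X (Y_class \<sigma> \<gamma>) E F A = multiple_summing_norm \<gamma> X E F A" for A
    by (simp only: block_summing_norm_def multiple_summing_norm_def op_norm_def block_induced_eq Y)
qed

end
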